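(* Let $\bar x\in\mathcal{F}$ be feasible for the problem $\min_{x\in\mathbb{R}^n} f(x)$ subject to $F(x)\in\Omega$, assume that the generalized Guignard constraint qualification (GGCQ) is satisfied at $\bar x$, and let ${\rm conv}\,T_{\rm lin}(\bar x)$ be finitely generated by the set $\mathcal{U}=\{u_1,\ldots,u_N\}\subset T_{\rm lin}(\bar x)$, i.e. ${\rm conv}\,T_{\rm lin}(\bar x)=\{\sum_{i=1}^N\alpha_iu_i : \alpha_i\ge 0,\ i=1,\ldots,N\}$. Then the following statements are equivalent: (a) $\bar x$ is B-stationary. (b) $\nabla f(\bar x)u\ge 0$ for all $u\in T_{\rm lin}(\bar x)$. (c) $\bar x$ is extended M-stationary. (d) For every direction $u\in\mathcal{U}\cap\mathcal{C}(\bar x)$ there holds $\Lambda^1(\bar x;u)\neq\emptyset$.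
   Context: Data: $f:\mathbb{R}^n\to\mathbb{R}$ and $F:\mathbb{R}^n\to\mathbb{R}^m$ are continuously differentiable, $\Omega=\bigcup_{i=1}^{\bar p}P_i\subset\mathbb{R}^m$ is a union of finitely many convex polyhedra, and $\mathcal{F}=\{x : F(x)\in\Omega\}$ is the feasible set. $\nabla f(x)$ (row vector) and $\nabla F(x)$ denote Jacobians. For a closed set $C\subset\mathbb{R}^d$ and $z\in C$: $T(z;C)=\{w : \exists\, w_k\to w,\ t_k\downarrow 0,\ z+t_kw_k\in C\}$ (contingent cone); $\hat N(z;C)=\{\xi : \limsup_{z'\to z,\ z'\in C}\xi^T(z'-z)/\|z'-z\|\le 0\}$ (Fréchet normal cone); both are $\emptyset$ if $z\notin C$. For $z\in C$ and $w\in\mathbb{R}^d$: $N(z;C;w)=\{\xi : \exists\, t_k\downarrow 0,\ w_k\to w,\ \xi_k\to\xi,\ \xi_k\in\hat N(z+t_kw_k;C)\ \forall k\}$ (Mordukhovich normal cone in direction $w$). Linearized cone: $T_{\rm lin}(\bar x)=\{u\in\mathbb{R}^n : \nabla F(\bar x)u\in T(F(\bar x);\Omega)\}$. Critical cone: $\mathcal{C}(\bar x)=\{u\in T_{\rm lin}(\bar x) : \nabla f(\bar x)u\le 0\}$. Multiplier set: $\Lambda^1(\bar x;u)=\{\lambda\in\mathbb{R}^m : \lambda\in N(F(\bar x);\Omega;\nabla F(\bar x)u),\ \nabla f(\bar x)^T+\nabla F(\bar x)^T\lambda=0\}$. GGCQ holds at $\bar x$ if $\hat N(\bar x;\mathcal{F})=\hat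 N(0;T_{\rm lin}(\bar x))$. The point $\bar x$ is B-stationary if $\nabla f(\bar x)u\ge 0$ for all $u\in T(\bar x;\mathcal{F})$; it is extended M-stationary if $\Lambda^1(\bar x;u)\neq\emptyset$ for all $u\in\mathcal{C}(\bar x)$. *)

theory Defs
  imports "HOL-Analysis.Analysis"
begin

definition cont_diff :: "('a::real_normed_vector \<Rightarrow> 'b::real_normed_vector) \<Rightarrow> bool" where
  "cont_diff g \<longleftrightarrow>
     (\<exists>g' :: 'a \<Rightarrow> 'a \<Rightarrow>\<^sub>L 'b.
        (\<forall>x. (g has_derivative blinfun_apply (g' x)) (at x)) \<and> continuous_on UNIV g')"

(* The Jacobian of a scalar function, as a vector: the row vector product with u is
   written as an inner product, and the vector itself is the transpose (column) form.
   For vector-valued functions the library's jacobian is used. *)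
definition grad :: "(real^'n \<Rightarrow> real) \<Rightarrow> real^'n \<Rightarrow> real^'n" where
  "grad f x = (\<chi> j. frechet_derivative f (at x) (axis j 1))"

definition contingent_cone :: "'a::euclidean_space \<Rightarrow> 'a set \<Rightarrow> 'a set" where
  "contingent_cone z C =
     {w. z \<in> C \<and>
         (\<exists>(ws :: nat \<Rightarrow> 'a) (t :: nat \<Rightarrow> real).
            ws \<longlonglongrightarrow> w \<and> (\<forall>k. t k > 0) \<and> t \<longlonglongrightarrow> 0 \<and>
            (\<forall>k. z + t k *\<^sub>R ws k \<in> C))}"

(* The filter excludes z' = z; at an isolated point of C it is trivial, the Limsup is
   minus infinity, and the cone is the whole space. *)
definition frechet_normal_cone :: "'a::euclidean_space \<Rightarrow> 'a set \<Rightarrow> 'a set" where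
  "frechet_normal_cone z C =
     {\<xi>. z \<in> C \<and>
         Limsup (at z within C) (\<lambda>z'. ereal (\<xi> \<bullet> (z' - z) / norm (z' - z))) \<le> 0}"

definition dir_normal_cone :: "'a::euclidean_space \<Rightarrow> 'a set \<Rightarrow> 'a \<Rightarrow> 'a set" where
  "dir_normal_cone z C w =
     {\<xi>. \<exists>(t :: nat \<Rightarrow> real) (ws :: nat \<Rightarrow> 'a) (\<xi>s :: nat \<Rightarrow> 'a).
           (\<forall>k. t k > 0) \<and> t \<longlonglongrightarrow> 0 \<and> ws \<longlonglongrightarrow> w \<and> \<xi>s \<longlonglongrightarrow> \<xi> \<and>
           (\<forall>k. \<xi>s k \<in> frechet_normal_cone (z + t k *\<^sub>R ws k) C)}"

definition feasible_set :: "(real^'n \<Rightarrow> real^'m) \<Rightarrow> (real^'m) set \<Rightarrow> (real^'n) set" where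
  "feasible_set F \<Omega> = {x. F x \<in> \<Omega>}"

definition lin_cone :: "(real^'n \<Rightarrow> real^'m) \<Rightarrow> (real^'m) set \<Rightarrow> real^'n \<Rightarrow> (real^'n) set" where
  "lin_cone F \<Omega> x = {u. jacobian F (at x) *v u \<in> contingent_cone (F x) \<Omega>}"

definition critical_cone ::
  "(real^'n \<Rightarrow> real) \<Rightarrow> (real^'n \<Rightarrow> real^'m) \<Rightarrow> (real^'m) set \<Rightarrow> real^'n \<Rightarrow> (real^'n) set" where
  "critical_cone f F \<Omega> x = {u \<in> lin_cone F \<Omega> x. grad f x \<bullet> u \<le> 0}"

definition multiplier_set ::
  "(real^'n \<Rightarrow> real) \<Rightarrow> (real^'n \<Rightarrow> real^'m) \<Rightarrow> (real^'m) set \<Rightarrow> real^'n \<Rightarrow> real^'n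
     \<Rightarrow> (real^'m) set" where
  "multiplier_set f F \<Omega> x u =
     {l. l \<in> dir_normal_cone (F x) \<Omega> (jacobian F (at x) *v u) \<and>
         grad f x + transpose (jacobian F (at x)) *v l = 0}"

definition GGCQ :: "(real^'n \<Rightarrow> real^'m) \<Rightarrow> (real^'m) set \<Rightarrow> real^'n \<Rightarrow> bool" where
  "GGCQ F \<Omega> x \<longleftrightarrow>
     frechet_normal_cone x (feasible_set F \<Omega>) = frechet_normal_cone 0 (lin_cone F \<Omega> x)"

definition B_stationary ::
  "(real^'n \<Rightarrow> real) \<Rightarrow> (real^'n \<Rightarrow> real^'m) \<Rightarrow> (real^'m) set \<Rightarrow> real^'n \<Rightarrow> bool" where
  "B_stationary f F \<Omega> x \<longleftrightarrow>
     (\<forall>u \<in> contingent_cone x (feasible_set F \<Omega>). grad f x \<bullet> u \<ge> 0)"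

definition extended_M_stationary ::
  "(real^'n \<Rightarrow> real) \<Rightarrow> (real^'n \<Rightarrow> real^'m) \<Rightarrow> (real^'m) set \<Rightarrow> real^'n \<Rightarrow> bool" where
  "extended_M_stationary f F \<Omega> x \<longleftrightarrow>
     (\<forall>u \<in> critical_cone f F \<Omega> x. multiplier_set f F \<Omega> x u \<noteq> {})"

end

theory Submission
  imports Defs
begin

text \<open>
  The Frechet normal cone is the polar of the contingent cone, so under GGCQ both (a) and (b) say
  that the negative gradient lies in the polar of the linearized cone. For (b) implies (c), the
  linear objective is nonnegative on every polyhedral piece of the linearized problem; the Farkas
  lemma on each piece shows that the distance to the constraint set is an exact penalty near the
  reference point. Quadratic penalty problems on contracting copies of the constraint set around a
  critical direction then have projections as minimisers, whose proximal normals remain bounded and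
  accumulate at the required directional multiplier. For (d) implies (b), a union of polyhedra is
  conic near each of its points, so a directional normal makes a nonpositive product with its
  direction; hence the gradient is nonnegative on each generator, and thus on the generated cone.
\<close>

section \<open>Frechet normals and contingent cones\<close>

text \<open>Clearing the denominator makes \<open>y = z\<close> satisfy the inequality trivially, so
  an isolated point of C needs no separate case.\<close>

lemma frechet_normal_cone_iff:
  "\<xi> \<in> frechet_normal_cone z C \<longleftrightarrow>
     z \<in> C \<and> (\<forall>e>0. \<exists>d>0. \<forall>y\<in>C. norm (y - z) < d \<longrightarrow> \<xi> \<bullet> (y - z) \<le> e * norm (y - z))"
  (is "_ \<longleftrightarrow> _ \<and> ?R")
proof -
  have "Limsup (at z within C) (\<lambda>y. ereal (\<xi> \<bullet> (y - z) / norm (y - z))) \<le> 0 \<longleftrightarrow> ?R"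
    (is "?L \<longleftrightarrow> _")
  proof
    assume L: ?L
    show ?R
    proof (intro allI impI)
      fix e :: real
      assume "e > 0"
      then have "\<forall>\<^sub>F y in at z within C. ereal (\<xi> \<bullet> (y - z) / norm (y - z)) < ereal e"
        using L unfolding Limsup_le_iff by (metis ereal_less(2))
      then obtain d where d: "d > 0"
        "\<And>y. y \<in> C \<Longrightarrow> y \<noteq> z \<Longrightarrow> dist y z < d \<Longrightarrow> \<xi> \<bullet> (y - z) / norm (y - z) < e"
        unfolding eventually_at by auto
      have "\<xi> \<bullet> (y - z) \<le> e * norm (y - z)" if "y \<in> C" "norm (y - z) < d" for y
        using d(2)[of y] that by (cases "y = z") (auto simp: dist_norm field_simps)
      with d(1) show "\<exists>d>0. \<forall>y\<in>C. norm (y - z) < d \<longrightarrow> \<xi> \<bullet> (y - z) \<le> e * norm (y - z)"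
        by blast
    qed
  next
    assume R: ?R
    show ?L
      unfolding Limsup_le_iff
    proof (intro allI impI)
      fix y :: ereal
      assume "0 < y"
      \<comment> \<open>The bound y may be infinite, hence a real e below it; the quotient is only
        shown to be \<le> e, and strictness comes from \<open>e < y\<close>.\<close>
      then obtain e where e: "0 < ereal e" "ereal e < y"
        using ereal_dense2 by blast
      then obtain d where d: "d > 0"
        "\<And>y. y \<in> C \<Longrightarrow> norm (y - z) < d \<Longrightarrow> \<xi> \<bullet> (y - z) \<le> e * norm (y - z)"
        using R by auto
      have "ereal (\<xi> \<bullet> (x - z) / norm (x - z)) < y" if "x \<in> C" "x \<noteq> z" "dist x z < d" for x
      proof -
        have "\<xi> \<bullet> (x - z) / norm (x - z) \<le> e"
          using d(2)[of x] that by (simp add: dist_norm field_simps)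
        with e(2) show ?thesis
          by (meson ereal_less_eq(3) le_less_trans)
      qed
      with d(1) show "\<forall>\<^sub>F x in at z within C. ereal (\<xi> \<bullet> (x - z) / norm (x - z)) < y"
        unfolding eventually_at by blast
    qed
  qed
  then show ?thesis
    by (simp add: frechet_normal_cone_def)
qed

text \<open>One inclusion passes to the limit along a sequence defining the tangent. For the other,
  normalised differences of a violating sequence lie on the unit sphere and accumulate at a tangent
  having positive product with \<xi>.\<close>

lemma frechet_normal_cone_eq_polar:
  assumes "z \<in> C"
  shows "frechet_normal_cone z C = {\<xi>. \<forall>w\<in>contingent_cone z C. \<xi> \<bullet> w \<le> 0}"
proof (intro set_eqI iffI)
  fix \<xi>
  assume \<xi>: "\<xi> \<in> frechet_normal_cone z C"
  have "\<xi> \<bullet> w \<le> 0" if w: "w \<in> contingent_cone z C" for w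
  proof -
    obtain ws t where ws: "ws \<longlonglongrightarrow> w" "\<And>k. t k > 0" "t \<longlonglongrightarrow> 0" "\<And>k. z + t k *\<^sub>R ws k \<in> C"
      using w unfolding contingent_cone_def by blast
    have small: "(\<lambda>k. norm (t k *\<^sub>R ws k)) \<longlonglongrightarrow> 0"
      using tendsto_norm[OF tendsto_scaleR[OF ws(3) ws(1)]] by simp
    have "\<xi> \<bullet> w \<le> e * norm w" if "e > 0" for e
    proof -
      obtain d where d: "d > 0"
        "\<And>y. y \<in> C \<Longrightarrow> norm (y - z) < d \<Longrightarrow> \<xi> \<bullet> (y - z) \<le> e * norm (y - z)"
        using \<xi> \<open>e > 0\<close> unfolding frechet_normal_cone_iff by blast
      have "\<forall>\<^sub>F k in sequentially. \<xi> \<bullet> ws k \<le> e * norm (ws k)"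
        using order_tendstoD(2)[OF small d(1)]
      proof eventually_elim
        case (elim k)
        have "t k * (\<xi> \<bullet> ws k) \<le> t k * (e * norm (ws k))"
          using d(2)[OF ws(4)[of k]] elim ws(2)[of k] by (simp add: ac_simps)
        then show ?case
          using ws(2)[of k] by simp
      qed
      then show ?thesis
        by (rule tendsto_le[OF sequentially_bot tendsto_mult_left[OF tendsto_norm[OF ws(1)]]
              tendsto_inner[OF tendsto_const ws(1)]])
    qed
    note le = this
    show ?thesis
    proof (rule ccontr)
      have pos: "0 < norm w + 1"
        by (simp add: add_nonneg_pos)
      assume "\<not> \<xi> \<bullet> w \<le> 0"
      \<comment> \<open>With this e the bound \<open>e * norm w\<close> is strictly below
        \<open>\<xi> \<bullet> w\<close>; the 1 also covers \<open>w = 0\<close>.\<close>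
      with pos le[of "(\<xi> \<bullet> w) / (norm w + 1)"] show False
        by (simp add: pos_le_divide_eq algebra_simps)
    qed
  qed
  then show "\<xi> \<in> {\<xi>. \<forall>w\<in>contingent_cone z C. \<xi> \<bullet> w \<le> 0}"
    by blast
next
  fix \<xi>
  assume \<xi>: "\<xi> \<in> {\<xi>. \<forall>w\<in>contingent_cone z C. \<xi> \<bullet> w \<le> 0}"
  show "\<xi> \<in> frechet_normal_cone z C"
  proof (rule ccontr)
    assume "\<xi> \<notin> frechet_normal_cone z C"
    then obtain e where "e > 0"
      and e: "\<And>d. d > 0 \<Longrightarrow> \<exists>y\<in>C. norm (y - z) < d \<and> e * norm (y - z) < \<xi> \<bullet> (y - z)"
      using assms unfolding frechet_normal_cone_iff by (meson not_le)
    have "\<forall>n. \<exists>y\<in>C. norm (y - z) < inverse (real (Suc n)) \<and> e * norm (y - z) < \<xi> \<bullet> (y - z)"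
      using e by simp
    then obtain Y where Y: "\<And>n. Y n \<in> C" "\<And>n. norm (Y n - z) < inverse (real (Suc n))"
      "\<And>n. e * norm (Y n - z) < \<xi> \<bullet> (Y n - z)"
      by metis
    define t where "t n = norm (Y n - z)" for n
    define ws where "ws n = (Y n - z) /\<^sub>R t n" for n
    \<comment> \<open>The strict violation excludes \<open>Y n = z\<close>, where both sides
      vanish.\<close>
    have t_pos: "t n > 0" for n
      using Y(3)[of n] by (auto simp: t_def)
    have t0: "t \<longlonglongrightarrow> 0"
      by (rule tendsto_sandwich[OF _ _ tendsto_const LIMSEQ_inverse_real_of_nat])
        (use Y(2) in \<open>auto simp: t_def intro!: always_eventually less_imp_le simp del: of_nat_Suc\<close>)
    have "\<forall>n. ws n \<in> sphere 0 1"
      using t_pos by (auto simp: ws_def t_def)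
    then obtain w r where r: "strict_mono (r :: nat \<Rightarrow> nat)" "(ws \<circ> r) \<longlonglongrightarrow> w"
      using compact_sphere[of 0 1, unfolded compact_def] by blast
    have "w \<in> contingent_cone z C"
      unfolding contingent_cone_def
    proof (intro CollectI conjI exI)
      show "(t \<circ> r) \<longlonglongrightarrow> 0"
        using LIMSEQ_subseq_LIMSEQ[OF t0 r(1)] .
      show "\<forall>k. z + (t \<circ> r) k *\<^sub>R (ws \<circ> r) k \<in> C"
        using Y(1) t_pos by (simp add: ws_def less_imp_neq[THEN not_sym])
    qed (use assms r t_pos in \<open>auto simp: o_def\<close>)
    then have "\<xi> \<bullet> w \<le> 0"
      using \<xi> by blast
    moreover have "e \<le> \<xi> \<bullet> w"
    proof (rule LIMSEQ_le_const[OF tendsto_inner[OF tendsto_const r(2)]], intro exI allI impI)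
      fix n
      show "e \<le> \<xi> \<bullet> (ws \<circ> r) n"
        using Y(3)[of "r n"] t_pos[of "r n"] by (simp add: ws_def t_def divide_inverse_commute[symmetric] pos_le_divide_eq)
    qed
    ultimately show False
      using \<open>e > 0\<close> by linarith
  qed
qed

lemma contingent_cone_mono: "S \<subseteq> T \<Longrightarrow> contingent_cone z S \<subseteq> contingent_cone z T"
  unfolding contingent_cone_def by blast

lemma contingent_coneI:
  assumes "z \<in> C" and "\<forall>\<^sub>F s in at_right 0. z + s *\<^sub>R w \<in> C"
  shows "w \<in> contingent_cone z C"
proof -
  obtain d where d: "d > 0" "\<And>s. 0 < s \<Longrightarrow> s < d \<Longrightarrow> z + s *\<^sub>R w \<in> C"
    using assms(2) unfolding eventually_at_right_field by blast
  \<comment> \<open>The double \<open>Suc\<close> starts the sequence at d/2, strictly below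
    d.\<close>
  define t where "t n = d * inverse (real (Suc (Suc n)))" for n
  have "0 < t n" "t n < d" for n
    using \<open>d > 0\<close> by (auto simp: t_def field_simps add_pos_nonneg)
  moreover have "t \<longlonglongrightarrow> 0"
    using tendsto_mult_left[OF LIMSEQ_Suc[OF LIMSEQ_inverse_real_of_nat], of d]
    by (simp add: t_def[abs_def])
  ultimately show ?thesis
    using assms(1) d(2) unfolding contingent_cone_def
    by (intro CollectI conjI exI[of _ "\<lambda>_. w"] exI[of _ t]) auto
qed

text \<open>Scaling the directions by s and the steps by 1/s leaves the points of C
  unchanged.\<close>

lemma conic_contingent_cone: "conic (contingent_cone z C)"
  unfolding conic_def
proof (intro allI impI)
  fix w and s :: real
  assume w: "w \<in> contingent_cone z C" and "0 \<le> s"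
  obtain ws t where ws: "z \<in> C" "ws \<longlonglongrightarrow> w" "\<And>k. t k > 0" "t \<longlonglongrightarrow> 0" "\<And>k. z + t k *\<^sub>R ws k \<in> C"
    using w unfolding contingent_cone_def by blast
  show "s *\<^sub>R w \<in> contingent_cone z C"
  proof (cases "s = 0")
    case True
    with \<open>z \<in> C\<close> show ?thesis
      by (intro contingent_coneI) auto
  next
    case False
    with \<open>0 \<le> s\<close> have "s > 0" by simp
    have "(\<lambda>k. s *\<^sub>R ws k) \<longlonglongrightarrow> s *\<^sub>R w" "(\<lambda>k. t k / s) \<longlonglongrightarrow> 0"
      using ws(2) tendsto_divide_zero[OF ws(4)] by (auto intro: tendsto_scaleR)
    then show ?thesis
      unfolding contingent_cone_def using ws \<open>s > 0\<close>
      by (intro CollectI conjI exI[of _ "\<lambda>k. s *\<^sub>R ws k"] exI[of _ "\<lambda>k. t k / s"]) auto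
  qed
qed

text \<open>Every u in K is itself tangent at 0, and conversely a nonpositive product is below
  \<open>e * norm y\<close> at any radius. This makes the right side of GGCQ a polar.\<close>

lemma frechet_normal_cone_conic:
  assumes "conic K" and "0 \<in> K"
  shows "frechet_normal_cone 0 K = {\<xi>. \<forall>u\<in>K. \<xi> \<bullet> u \<le> 0}"
proof -
  have "u \<in> contingent_cone 0 K" if "u \<in> K" for u
  proof (rule contingent_coneI)
    show "\<forall>\<^sub>F s in at_right 0. 0 + s *\<^sub>R u \<in> K"
      using eventually_at_right_less[of "0::real"]
      by eventually_elim (use conicD[OF assms(1) that] in auto)
  qed fact
  moreover have "\<xi> \<in> frechet_normal_cone 0 K" if "\<forall>u\<in>K. \<xi> \<bullet> u \<le> 0" for \<xi>
    unfolding frechet_normal_cone_iff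
  proof (intro conjI allI impI exI[of _ "1::real"] ballI)
    fix e y assume "(0::real) < e" "y \<in> K"
    then have "\<xi> \<bullet> y \<le> 0" "0 \<le> e * norm y"
      using that by auto
    then show "\<xi> \<bullet> (y - 0) \<le> e * norm (y - 0)"
      by simp
  qed (use assms(2) in auto)
  ultimately show ?thesis
    unfolding frechet_normal_cone_eq_polar[OF assms(2)]
    using frechet_normal_cone_eq_polar[OF assms(2)] by blast
qed

section \<open>Unions of polyhedra near a point\<close>

text \<open>Inside a small ball, S agrees with a cone with apex z. Including \<open>s = 0\<close>
  forces S to miss the ball when z is outside S.\<close>

definition conic_near :: "'a::real_normed_vector \<Rightarrow> 'a set \<Rightarrow> bool" where
  "conic_near z S \<longleftrightarrow>
     (\<exists>\<delta>>0. \<forall>w s. z + w \<in> S \<longrightarrow> norm w < \<delta> \<longrightarrow> 0 \<le> s \<longrightarrow> norm (s *\<^sub>R w) < \<delta>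
        \<longrightarrow> z + s *\<^sub>R w \<in> S)"

lemma conic_near_Int:
  assumes "conic_near z S" and "conic_near z T"
  shows "conic_near z (S \<inter> T)"
proof -
  obtain a where a: "a > 0" "\<And>w s. z + w \<in> S \<Longrightarrow> norm w < a \<Longrightarrow> 0 \<le> s \<Longrightarrow> norm (s *\<^sub>R w) < a
        \<Longrightarrow> z + s *\<^sub>R w \<in> S"
    using assms(1) unfolding conic_near_def by blast
  obtain b where b: "b > 0" "\<And>w s. z + w \<in> T \<Longrightarrow> norm w < b \<Longrightarrow> 0 \<le> s \<Longrightarrow> norm (s *\<^sub>R w) < b
        \<Longrightarrow> z + s *\<^sub>R w \<in> T"
    using assms(2) unfolding conic_near_def by blast
  show ?thesis
    unfolding conic_near_def using a b by (intro exI[of _ "min a b"]) auto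
qed

lemma conic_near_Un:
  assumes "conic_near z S" and "conic_near z T"
  shows "conic_near z (S \<union> T)"
proof -
  obtain a where a: "a > 0" "\<And>w s. z + w \<in> S \<Longrightarrow> norm w < a \<Longrightarrow> 0 \<le> s \<Longrightarrow> norm (s *\<^sub>R w) < a
        \<Longrightarrow> z + s *\<^sub>R w \<in> S"
    using assms(1) unfolding conic_near_def by blast
  obtain b where b: "b > 0" "\<And>w s. z + w \<in> T \<Longrightarrow> norm w < b \<Longrightarrow> 0 \<le> s \<Longrightarrow> norm (s *\<^sub>R w) < b
        \<Longrightarrow> z + s *\<^sub>R w \<in> T"
    using assms(2) unfolding conic_near_def by blast
  show ?thesis
    unfolding conic_near_def using a b by (intro exI[of _ "min a b"]) auto
qed

lemma conic_near_halfspace: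
  assumes "a \<noteq> 0"
  shows "conic_near z {x. a \<bullet> x \<le> b}"
proof (cases "a \<bullet> z = b")
  case True
  then show ?thesis
    unfolding conic_near_def
    by (intro exI[of _ 1]) (auto simp: inner_add_right mult_nonneg_nonpos)
next
  case False
  \<comment> \<open>The distance from z to the bounding hyperplane: within it
    \<open>b - a \<bullet> x\<close> keeps its sign, so the ball lies wholly inside or wholly
    outside the halfspace.\<close>
  define \<delta> where "\<delta> = \<bar>b - a \<bullet> z\<bar> / norm a"
  have "\<bar>a \<bullet> w\<bar> < \<bar>b - a \<bullet> z\<bar>" if "norm w < \<delta>" for w
  proof -
    have "\<bar>a \<bullet> w\<bar> \<le> norm a * norm w"
      by (rule Cauchy_Schwarz_ineq2)
    also have "\<dots> < \<bar>b - a \<bullet> z\<bar>"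
      using that assms by (simp add: \<delta>_def field_simps)
    finally show ?thesis .
  qed
  note bound = this
  have "z + s *\<^sub>R w \<in> {x. a \<bullet> x \<le> b}"
    if "z + w \<in> {x. a \<bullet> x \<le> b}" "norm w < \<delta>" "norm (s *\<^sub>R w) < \<delta>" for w s
    using that(1) that(2,3)[THEN bound] by (auto simp: inner_add_right)
  moreover have "\<delta> > 0"
    using False assms by (simp add: \<delta>_def)
  ultimately show ?thesis
    unfolding conic_near_def by blast
qed

lemma conic_near_polyhedron:
  assumes "polyhedron S"
  shows "conic_near z S"
proof -
  obtain \<H> where \<H>: "finite \<H>" "S = \<Inter>\<H>" "\<forall>h\<in>\<H>. \<exists>a b. a \<noteq> 0 \<and> h = {x. a \<bullet> x \<le> b}"
    using assms unfolding polyhedron_def by blast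
  have "conic_near z (\<Inter>\<H>)"
    using \<H>(1,3)
  proof induction
    case empty
    show ?case by (auto simp: conic_near_def intro: exI[of _ 1])
  next
    case (insert h \<H>)
    have "conic_near z h"
      using insert.prems conic_near_halfspace by (metis insertI1)
    with insert show ?case
      by (simp add: conic_near_Int)
  qed
  with \<H>(2) show ?thesis by simp
qed

lemma conic_near_Union_polyhedron:
  assumes "finite \<P>" and "\<And>S. S \<in> \<P> \<Longrightarrow> polyhedron S"
  shows "conic_near z (\<Union>\<P>)"
  using assms
proof induction
  case empty
  show ?case by (auto simp: conic_near_def intro: exI[of _ 1])
next
  case (insert S \<P>)
  then show ?case
    by (simp add: conic_near_Un conic_near_polyhedron)
qed

text \<open>Near z the points \<open>z + t k *\<^sub>R ws k\<close> can be rescaled to the fixed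
  step s without leaving S; closedness then admits the limit in k.\<close>

lemma contingent_cone_feasible_direction:
  assumes "conic_near z S" and "closed S" and w: "w \<in> contingent_cone z S"
  obtains \<tau> where "\<tau> > 0" and "\<And>s. 0 < s \<Longrightarrow> s < \<tau> \<Longrightarrow> z + s *\<^sub>R w \<in> S"
proof -
  obtain \<delta> where \<delta>: "\<delta> > 0" "\<And>w s. z + w \<in> S \<Longrightarrow> norm w < \<delta> \<Longrightarrow> 0 \<le> s \<Longrightarrow> norm (s *\<^sub>R w) < \<delta>
        \<Longrightarrow> z + s *\<^sub>R w \<in> S"
    using assms(1) unfolding conic_near_def by blast
  obtain ws t where ws: "ws \<longlonglongrightarrow> w" "\<And>k. t k > 0" "t \<longlonglongrightarrow> 0" "\<And>k. z + t k *\<^sub>R ws k \<in> S"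
    using w unfolding contingent_cone_def by blast
  have small: "(\<lambda>k. norm (t k *\<^sub>R ws k)) \<longlonglongrightarrow> 0"
    using tendsto_norm[OF tendsto_scaleR[OF ws(3) ws(1)]] by simp
  show thesis
  proof
    show "\<delta> / (norm w + 1) > 0"
      using \<delta>(1) by (simp add: add_nonneg_pos)
    fix s :: real
    assume s: "0 < s" "s < \<delta> / (norm w + 1)"
    have "s * norm w < \<delta>"
      using s by (simp add: pos_less_divide_eq add_nonneg_pos distrib_left)
    moreover have "(\<lambda>k. norm (s *\<^sub>R ws k)) \<longlonglongrightarrow> s * norm w"
      using tendsto_norm[OF tendsto_scaleR[OF tendsto_const ws(1)], of s] s(1) by simp
    ultimately have "\<forall>\<^sub>F k in sequentially. norm (s *\<^sub>R ws k) < \<delta>"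
      by (rule order_tendstoD(2)[rotated])
    then have "\<forall>\<^sub>F k in sequentially. z + s *\<^sub>R ws k \<in> S"
      using order_tendstoD(2)[OF small \<delta>(1)]
    proof eventually_elim
      case (elim k)
      show ?case
        using \<delta>(2)[OF ws(4)[of k] elim(2), of "s / t k"] elim(1) ws(2)[of k] s(1)
        by (simp add: less_imp_neq[THEN not_sym])
    qed
    moreover have "(\<lambda>k. z + s *\<^sub>R ws k) \<longlonglongrightarrow> z + s *\<^sub>R w"
      by (intro tendsto_intros ws(1))
    ultimately show "z + s *\<^sub>R w \<in> S"
      by (rule Lim_in_closed_set[OF assms(2) _ sequentially_bot])
  qed
qed

text \<open>Near z the set S contains a piece of the ray from z beyond each point
  \<open>z + y\<close> of S, so y is tangent there and has nonpositive product with a Frechet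
  normal. Dividing by \<open>t k\<close> and taking limits gives the claim.\<close>

lemma dir_normal_cone_inner_nonpos:
  assumes "conic_near z S" and "\<xi> \<in> dir_normal_cone z S w"
  shows "\<xi> \<bullet> w \<le> 0"
proof -
  obtain \<delta> where \<delta>: "\<delta> > 0" "\<And>w s. z + w \<in> S \<Longrightarrow> norm w < \<delta> \<Longrightarrow> 0 \<le> s \<Longrightarrow> norm (s *\<^sub>R w) < \<delta>
        \<Longrightarrow> z + s *\<^sub>R w \<in> S"
    using assms(1) unfolding conic_near_def by blast
  obtain t ws \<xi>s where seq: "\<And>k. t k > 0" "t \<longlonglongrightarrow> 0" "ws \<longlonglongrightarrow> w" "\<xi>s \<longlonglongrightarrow> \<xi>"
    "\<And>k. \<xi>s k \<in> frechet_normal_cone (z + t k *\<^sub>R ws k) S"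
    using assms(2) unfolding dir_normal_cone_def by blast
  have small: "(\<lambda>k. norm (t k *\<^sub>R ws k)) \<longlonglongrightarrow> 0"
    using tendsto_norm[OF tendsto_scaleR[OF seq(2) seq(3)]] by simp
  have "\<forall>\<^sub>F k in sequentially. \<xi>s k \<bullet> ws k \<le> 0"
    using order_tendstoD(2)[OF small \<delta>(1)]
  proof eventually_elim
    case (elim k)
    define y where "y = t k *\<^sub>R ws k"
    have y: "z + y \<in> S" "norm y < \<delta>"
      using seq(5)[of k] elim by (auto simp: frechet_normal_cone_def y_def)
    have "y \<in> contingent_cone (z + y) S"
    proof (rule contingent_coneI)
      have "((\<lambda>s. norm ((1 + s) *\<^sub>R y)) \<longlongrightarrow> norm ((1 + 0) *\<^sub>R y)) (at_right 0)"
        by (intro tendsto_intros)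
      then have "\<forall>\<^sub>F s in at_right 0. norm ((1 + s) *\<^sub>R y) < \<delta>"
        by (rule order_tendstoD(2)) (use y in simp)
      then show "\<forall>\<^sub>F s in at_right 0. z + y + s *\<^sub>R y \<in> S"
        using eventually_at_right_less[of 0]
      proof eventually_elim
        case (elim s)
        then show ?case
          using \<delta>(2)[OF y, of "1 + s"] by (simp add: algebra_simps)
      qed
    qed fact
    then have "\<xi>s k \<bullet> y \<le> 0"
      using seq(5)[of k] frechet_normal_cone_eq_polar[OF y(1)] unfolding y_def by blast
    then show ?case
      using seq(1)[of k] by (simp add: y_def mult_le_0_iff)
  qed
  then show ?thesis
    using tendsto_upperbound[OF tendsto_inner[OF seq(4,3)]] sequentially_bot by blast
qed

section \<open>Multipliers\<close>

text \<open>Farkas lemma: if \<open>- c\<close> were outside the cone generated by the images of the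
  active normals, a separating vector would give a tangent direction along which c is
  negative.\<close>

lemma polyhedron_multiplier:
  fixes L :: "'a::euclidean_space \<Rightarrow> 'b::euclidean_space"
  assumes "polyhedron S" and "z \<in> S" and "linear L"
    and c: "\<And>v. L v \<in> contingent_cone z S \<Longrightarrow> 0 \<le> c \<bullet> v"
  obtains l where "c + adjoint L l = 0" and "\<And>x. x \<in> S \<Longrightarrow> l \<bullet> (x - z) \<le> 0"
proof -
  obtain \<H> where \<H>: "finite \<H>" "S = \<Inter>\<H>" "\<forall>h\<in>\<H>. \<exists>a b. a \<noteq> 0 \<and> h = {x. a \<bullet> x \<le> b}"
    using assms(1) unfolding polyhedron_def by blast
  then obtain a b where ab: "\<And>h. h \<in> \<H> \<Longrightarrow> h = {x. a h \<bullet> x \<le> b h}"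
    by metis
  have z_le: "a h \<bullet> z \<le> b h" if "h \<in> \<H>" for h
    using ab[OF that] that assms(2) \<H>(2) by auto
  \<comment> \<open>Normals of the constraints active at z; the inactive ones hold strictly and do
    not restrict directions.\<close>
  define J where "J = a ` {h \<in> \<H>. a h \<bullet> z = b h}"
  have "- c \<in> adjoint L ` (convex_cone hull J)"
  proof (rule ccontr)
    define K where "K = convex_cone hull (adjoint L ` J)"
    assume "- c \<notin> adjoint L ` (convex_cone hull J)"
    then have "- c \<notin> K"
      using convex_cone_hull_linear_image[OF adjoint_linear[OF assms(3)]] by (simp add: K_def)
    \<comment> \<open>Closedness, needed for strict separation, comes from the finite generation of
      K.\<close>
    moreover have "convex K" "closed K"
      using \<H>(1) by (auto simp: K_def J_def convex_convex_cone_hull closed_convex_cone_hull)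
    ultimately obtain v \<beta> where v: "v \<bullet> (- c) < \<beta>" "\<forall>x\<in>K. \<beta> < v \<bullet> x"
      using separating_hyperplane_closed_point by blast
    have "\<beta> < 0"
      using v(2) convex_cone_hull_contains_0[of "adjoint L ` J"] by (force simp: K_def)
    have v_nonneg: "0 \<le> v \<bullet> x" if "x \<in> K" for x
    proof (rule ccontr)
      assume neg: "\<not> 0 \<le> v \<bullet> x"
      \<comment> \<open>This positive multiple of x has product exactly \<beta> with v, against the
        strict separation.\<close>
      have "(\<beta> / (v \<bullet> x)) *\<^sub>R x \<in> K"
        using that neg \<open>\<beta> < 0\<close> unfolding K_def
        by (intro convex_cone_hull_mul) (auto simp: divide_nonpos_neg)
      with v(2) neg show False
        by force
    qed
    have "L (- v) \<in> contingent_cone z S"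
    proof (rule contingent_coneI[OF assms(2)])
      have "\<forall>\<^sub>F s in at_right 0. z + s *\<^sub>R L (- v) \<in> h" if "h \<in> \<H>" for h
      proof (cases "a h \<bullet> z = b h")
        case True
        then have "adjoint L (a h) \<in> K"
          using that unfolding K_def J_def by (auto intro!: hull_inc)
        then have "0 \<le> L v \<bullet> a h"
          using v_nonneg adjoint_works[OF assms(3)] by metis
        then have "a h \<bullet> L (- v) \<le> 0"
          by (simp add: linear_neg[OF assms(3)] inner_commute)
        have "z + s *\<^sub>R L (- v) \<in> h" if "0 < s" for s
          using True \<open>a h \<bullet> L (- v) \<le> 0\<close> that
          by (subst ab[OF \<open>h \<in> \<H>\<close>]) (simp add: inner_add_right mult_nonneg_nonpos)
        then show ?thesis
          by (intro eventually_mono[OF eventually_at_right_less])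
      next
        case False
        then have "a h \<bullet> (z + 0 *\<^sub>R L (- v)) < b h"
          using z_le[OF that] by simp
        moreover have "((\<lambda>s. a h \<bullet> (z + s *\<^sub>R L (- v))) \<longlongrightarrow> a h \<bullet> (z + 0 *\<^sub>R L (- v))) (at_right 0)"
          by (intro tendsto_intros)
        ultimately have "\<forall>\<^sub>F s in at_right 0. a h \<bullet> (z + s *\<^sub>R L (- v)) < b h"
          by (rule order_tendstoD(2)[rotated])
        then show ?thesis
          by eventually_elim (subst ab[OF that], simp)
      qed
      then show "\<forall>\<^sub>F s in at_right 0. z + s *\<^sub>R L (- v) \<in> S"
        unfolding \<H>(2) by (simp add: eventually_ball_finite[OF \<H>(1)])
    qed
    then have "0 \<le> c \<bullet> (- v)"
      by (rule c)
    with v(1) \<open>\<beta> < 0\<close> show False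
      by (simp add: inner_commute)
  qed
  then obtain l where l: "- c = adjoint L l" "l \<in> convex_cone hull J"
    by blast
  show thesis
  proof
    show "c + adjoint L l = 0"
      using l(1) by (metis add.right_inverse)
    fix x assume "x \<in> S"
    have "a h \<bullet> x \<le> b h" if "h \<in> \<H>" for h
      using \<open>x \<in> S\<close> \<H>(2) ab[OF that] that by auto
    then have "J \<subseteq> {y. (x - z) \<bullet> y \<le> 0}"
      by (auto simp: J_def inner_diff_left inner_commute[of _ "a _"])
    then have "convex_cone hull J \<subseteq> {y. (x - z) \<bullet> y \<le> 0}"
      by (rule hull_minimal) (rule convex_cone_halfspace_le)
    with l(2) show "l \<bullet> (x - z) \<le> 0"
      by (auto simp: inner_commute)
  qed
qed

text \<open>Nonnegativity of \<open>c \<bullet> v + \<sigma> * norm (L v - w)\<close>, with only w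
  localised. Unlike a common multiplier, which the pieces need not share, this property passes to
  unions with the larger \<sigma> and the smaller \<delta>.\<close>

definition exact_penalty ::
  "'a::euclidean_space \<Rightarrow> ('a \<Rightarrow> 'b::euclidean_space) \<Rightarrow> 'b \<Rightarrow> 'b set \<Rightarrow> bool" where
  "exact_penalty c L z S \<longleftrightarrow>
     (\<exists>\<sigma>\<ge>0. \<exists>\<delta>>0. \<forall>v w. z + w \<in> S \<longrightarrow> norm w < \<delta> \<longrightarrow> - \<sigma> * norm (L v - w) \<le> c \<bullet> v)"

lemma exact_penalty_Un:
  assumes "exact_penalty c L z S" and "exact_penalty c L z T"
  shows "exact_penalty c L z (S \<union> T)"
proof -
  obtain \<sigma> \<delta> where S: "\<sigma> \<ge> 0" "\<delta> > 0"
    "\<And>v w. z + w \<in> S \<Longrightarrow> norm w < \<delta> \<Longrightarrow> - \<sigma> * norm (L v - w) \<le> c \<bullet> v"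
    using assms(1) unfolding exact_penalty_def by blast
  obtain \<sigma>' \<delta>' where T: "\<sigma>' \<ge> 0" "\<delta>' > 0"
    "\<And>v w. z + w \<in> T \<Longrightarrow> norm w < \<delta>' \<Longrightarrow> - \<sigma>' * norm (L v - w) \<le> c \<bullet> v"
    using assms(2) unfolding exact_penalty_def by blast
  have "- max \<sigma> \<sigma>' * norm (L v - w) \<le> c \<bullet> v"
    if "z + w \<in> S \<union> T" "norm w < min \<delta> \<delta>'" for v w
  proof -
    have "- max \<sigma> \<sigma>' * norm (L v - w) \<le> - \<sigma> * norm (L v - w)"
      "- max \<sigma> \<sigma>' * norm (L v - w) \<le> - \<sigma>' * norm (L v - w)"
      by (auto intro!: mult_right_mono)
    with S(3) T(3) that show ?thesis
      by (metis Un_iff min_less_iff_conj order_trans)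
  qed
  with S T show ?thesis
    unfolding exact_penalty_def
    by (intro exI[of _ "max \<sigma> \<sigma>'"] exI[of _ "min \<delta> \<delta>'"] conjI) auto
qed

text \<open>For z in S the Farkas multiplier l gives
  \<open>c \<bullet> v = - l \<bullet> (L v - w) - l \<bullet> w\<close> with
  \<open>l \<bullet> w \<le> 0\<close>, so \<open>norm l\<close> serves as weight. Otherwise S keeps
  a positive distance from z and the condition is vacuous.\<close>

lemma exact_penalty_polyhedron:
  assumes "polyhedron S" and "linear L"
    and "\<And>v. L v \<in> contingent_cone z S \<Longrightarrow> 0 \<le> c \<bullet> v"
  shows "exact_penalty c L z S"
proof (cases "z \<in> S")
  case True
  obtain l where l: "c + adjoint L l = 0" "\<And>x. x \<in> S \<Longrightarrow> l \<bullet> (x - z) \<le> 0"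
    using polyhedron_multiplier[OF assms(1) True assms(2,3)] by blast
  have "- norm l * norm (L v - w) \<le> c \<bullet> v" if "z + w \<in> S" for v w
  proof -
    have "c \<bullet> v = - (l \<bullet> L v)"
      using l(1) adjoint_works[OF assms(2), of v l]
      by (metis add.commute add_eq_0_iff inner_commute inner_minus_left)
    moreover have "l \<bullet> L v = l \<bullet> (L v - w) + l \<bullet> w"
      by (simp add: inner_diff_right)
    moreover have "l \<bullet> w \<le> 0"
      using l(2)[OF that] by simp
    moreover have "l \<bullet> (L v - w) \<le> norm l * norm (L v - w)"
      by (rule norm_cauchy_schwarz)
    ultimately show ?thesis
      by simp
  qed
  then show ?thesis
    unfolding exact_penalty_def
    by (intro exI[of _ "norm l"] exI[of _ 1] conjI) auto
next
  case False
  then obtain \<delta> where \<delta>: "\<delta> > 0" "\<And>y. y \<in> S \<Longrightarrow> \<delta> \<le> dist z y"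
    using separate_point_closed[OF polyhedron_imp_closed[OF assms(1)]] by blast
  have "\<not> norm w < \<delta>" if "z + w \<in> S" for w
    using \<delta>(2)[OF that] by (simp add: dist_norm)
  with \<delta>(1) show ?thesis
    unfolding exact_penalty_def by (intro exI[of _ 0] exI[of _ \<delta>] conjI) auto
qed

text \<open>Tangents to a piece are tangents to the union, so the sign condition on c descends to
  every piece.\<close>

lemma exact_penalty_Union_polyhedron:
  assumes "finite \<P>" and "\<And>S. S \<in> \<P> \<Longrightarrow> polyhedron S" and "linear L"
    and "\<And>v. L v \<in> contingent_cone z (\<Union>\<P>) \<Longrightarrow> 0 \<le> c \<bullet> v"
  shows "exact_penalty c L z (\<Union>\<P>)"
  using assms(1,2,4)
proof induction
  case empty
  show ?case
    by (auto simp: exact_penalty_def intro!: exI[of _ 0] exI[of _ "1::real"])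
next
  case (insert S \<P>)
  have "contingent_cone z S \<subseteq> contingent_cone z (\<Union>(insert S \<P>))"
    "contingent_cone z (\<Union>\<P>) \<subseteq> contingent_cone z (\<Union>(insert S \<P>))"
    by (auto intro!: contingent_cone_mono)
  then have "0 \<le> c \<bullet> v" if "L v \<in> contingent_cone z S \<or> L v \<in> contingent_cone z (\<Union>\<P>)" for v
    using insert.prems(2)[of v] that by blast
  then have "exact_penalty c L z S" "exact_penalty c L z (\<Union>\<P>)"
    using insert.prems(1) by (auto intro!: exact_penalty_polyhedron insert.IH assms(3))
  then show ?case
    by (simp add: exact_penalty_Un)
qed

section \<open>Directional multipliers from quadratic penalisation\<close>

lemma proximal_imp_frechet_normal:
  assumes "x \<in> S" and "\<And>y. y \<in> S \<Longrightarrow> norm (y - x) < r \<Longrightarrow> \<xi> \<bullet> (y - x) \<le> M * (norm (y - x))\<^sup>2"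
    and "r > 0"
  shows "\<xi> \<in> frechet_normal_cone x S"
  unfolding frechet_normal_cone_iff
proof (intro conjI allI impI)
  fix e :: real assume "e > 0"
  \<comment> \<open>The second bound yields \<open>M * norm (y - x) \<le> e\<close> whatever the
    sign of M.\<close>
  define d where "d = min r (e / (\<bar>M\<bar> + 1))"
  have "\<xi> \<bullet> (y - x) \<le> e * norm (y - x)" if "y \<in> S" "norm (y - x) < d" for y
  proof -
    have "(\<bar>M\<bar> + 1) * norm (y - x) \<le> e"
      using that(2) by (simp add: d_def pos_less_divide_eq mult.commute)
    then have "M * norm (y - x) \<le> e"
      by (smt (verit) mult_right_mono norm_ge_zero)
    then have "M * (norm (y - x))\<^sup>2 \<le> e * norm (y - x)"
      unfolding power2_eq_square mult.assoc[symmetric] by (rule mult_right_mono) simp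
    with assms(2)[of y] that show ?thesis
      by (simp add: d_def)
  qed
  moreover have "d > 0"
    using \<open>e > 0\<close> \<open>r > 0\<close> by (simp add: d_def)
  ultimately show "\<exists>d>0. \<forall>y\<in>S. norm (y - x) < d \<longrightarrow> \<xi> \<bullet> (y - x) \<le> e * norm (y - x)"
    by blast
qed fact

text \<open>Minimising the quadratically penalised function
  \<^term>\<open>\<lambda>(v, y). c \<bullet> v + k / 2 * (norm (L v - y))\<^sup>2 + (norm (v - u))\<^sup>2 / 2\<close> over
  \<^term>\<open>z + t *\<^sub>R y \<in> S\<close> yields the multiplier \<^term>\<open>k *\<^sub>R (L v - y)\<close>; comparing the minimum
  with the exact penalty bounds it independently of \<^term>\<open>k\<close>.\<close>

lemma approximate_multiplier:
  fixes L :: "'a::euclidean_space \<Rightarrow> 'b::euclidean_space"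
  assumes "closed S" and L: "linear L" and "c \<bullet> u \<le> 0"
    and "\<sigma> \<ge> 0" and "\<delta> > 0"
    and penalty: "\<And>v w. z + w \<in> S \<Longrightarrow> norm w < \<delta> \<Longrightarrow> - \<sigma> * norm (L v - w) \<le> c \<bullet> v"
    and "\<tau> > 0" and feasible: "\<And>s. 0 < s \<Longrightarrow> s < \<tau> \<Longrightarrow> z + s *\<^sub>R L u \<in> S"
    and "\<epsilon> > 0"
  obtains t v y l where "0 < t" "t < \<epsilon>" "norm (v - u) < \<epsilon>" "norm (y - L u) < \<epsilon>"
    "norm l \<le> 2 * \<sigma>" "l \<in> frechet_normal_cone (z + t *\<^sub>R y) S" "c + adjoint L l + (v - u) = 0"
proof -
  obtain B where B: "B > 0" "\<And>x. norm (L x) \<le> B * norm x"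
    using linear_bounded_pos[OF L] by blast
  \<comment> \<open>Bounding d and e below by \<eta> will put y within
    \<open>(B + 1) * \<eta>\<close> of \<open>L u\<close>; the cap 1 keeps the minimiser off the
    boundary of the unit balls.\<close>
  define \<eta> where "\<eta> = min \<epsilon> 1 / (B + 1)"
  have \<eta>: "0 < \<eta>" "(B + 1) * \<eta> = min \<epsilon> 1"
    using \<open>\<epsilon> > 0\<close> B(1) by (auto simp: \<eta>_def)
  have \<eta>_le: "\<eta> \<le> min \<epsilon> 1"
    using \<eta> B(1) by (smt (verit) mult_le_cancel_right1)
  \<comment> \<open>Then \<open>k * \<eta>\<^sup>2\<close> exceeds both 2\<sigma> and 4\<sigma>^2,
    which forces \<open>d < \<eta>\<^sup>2\<close> and \<open>e < \<eta>\<close> below.\<close>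
  define k where "k = 4 * (\<sigma> + 1)\<^sup>2 / \<eta>\<^sup>2"
  have "k > 0"
    using \<eta>(1) \<open>\<sigma> \<ge> 0\<close> by (simp add: k_def)
  \<comment> \<open>The three bounds ensure \<open>t < \<epsilon>\<close>, feasibility of
    \<open>(u, L u)\<close>, and \<open>norm (t *\<^sub>R y) < \<delta>\<close> whenever y is within
    1 of \<open>L u\<close>.\<close>
  define t where "t = min (\<epsilon> / 2) (min (\<tau> / 2) (\<delta> / (norm (L u) + 2)))"
  have Lu: "0 < norm (L u) + 2"
    by (simp add: add_nonneg_pos)
  have t: "0 < t" "t < \<epsilon>" "t < \<tau>"
    using \<open>\<epsilon> > 0\<close> \<open>\<tau> > 0\<close> \<open>\<delta> > 0\<close> Lu by (auto simp: t_def)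
  have t_\<delta>: "t * (norm (L u) + 2) \<le> \<delta>"
    unfolding pos_le_divide_eq[OF Lu, symmetric] by (simp add: t_def)
  define D where "D = cball u 1 \<times> (cball (L u) 1 \<inter> (\<lambda>y. z + t *\<^sub>R y) -` S)"
  define \<phi> where "\<phi> = (\<lambda>(v, y). c \<bullet> v + k / 2 * (norm (L v - y))\<^sup>2 + (norm (v - u))\<^sup>2 / 2)"
  have "compact D"
    unfolding D_def using \<open>closed S\<close>
    by (intro compact_Times compact_Int_closed compact_cball)
      (auto intro!: continuous_closed_vimage continuous_intros)
  moreover have uD: "(u, L u) \<in> D"
    using feasible t by (simp add: D_def)
  moreover have "continuous_on D \<phi>"
    unfolding \<phi>_def case_prod_unfold
    by (intro continuous_intros linear_continuous_on_compose[OF _ L]) auto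
  ultimately obtain v y where vy: "(v, y) \<in> D" "\<And>v' y'. (v', y') \<in> D \<Longrightarrow> \<phi> (v, y) \<le> \<phi> (v', y')"
    using continuous_attains_inf[of D \<phi>] by fast
  have y: "norm (y - L u) \<le> 1" "z + t *\<^sub>R y \<in> S"
    using vy(1) by (auto simp: D_def dist_norm norm_minus_commute)
  define d where "d = norm (L v - y)"
  define e where "e = norm (v - u)"
  have "0 \<le> d" "0 \<le> e"
    by (auto simp: d_def e_def)
  have "norm y < norm (L u) + 2"
    using y(1) norm_triangle_ineq2[of y "L u"] by simp
  then have "t * norm y < t * (norm (L u) + 2)"
    using t(1) by (rule mult_strict_left_mono)
  then have "norm (t *\<^sub>R y) < \<delta>"
    using t(1) t_\<delta> unfolding norm_scaleR by linarith
  \<comment> \<open>The exact penalty is applied to the scaled pair; by homogeneity t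
    cancels.\<close>
  then have "- \<sigma> * norm (L (t *\<^sub>R v) - t *\<^sub>R y) \<le> c \<bullet> (t *\<^sub>R v)"
    by (rule penalty[OF y(2)])
  moreover have "norm (L (t *\<^sub>R v) - t *\<^sub>R y) = t * d"
    using t(1) by (simp add: d_def linear_cmul[OF L] scaleR_diff_right[symmetric])
  ultimately have "t * (- \<sigma> * d) \<le> t * (c \<bullet> v)"
    by (simp add: ac_simps)
  then have "- \<sigma> * d \<le> c \<bullet> v"
    using t(1) by (rule mult_left_le_imp_le)
  moreover have "\<phi> (v, y) \<le> \<phi> (u, L u)"
    using vy(2) uD by blast
  \<comment> \<open>The minimum is at most the value \<open>c \<bullet> u \<le> 0\<close> at
    \<open>(u, L u)\<close>, while \<open>c \<bullet> v\<close> is at least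
    \<open>- \<sigma> * d\<close>.\<close>
  ultimately have main: "k / 2 * d\<^sup>2 + e\<^sup>2 / 2 \<le> \<sigma> * d"
    using \<open>c \<bullet> u \<le> 0\<close> by (simp add: \<phi>_def d_def e_def)
  have kd: "k * d \<le> 2 * \<sigma>"
  proof (cases "d = 0")
    case False
    have "k / 2 * d\<^sup>2 \<le> \<sigma> * d"
      using main zero_le_power2[of e] by linarith
    then have "d * (k * d) \<le> d * (2 * \<sigma>)"
      by (simp add: power2_eq_square algebra_simps)
    then show ?thesis
      using False \<open>0 \<le> d\<close> by simp
  qed (use \<open>\<sigma> \<ge> 0\<close> in simp)
  have k_eq: "k * \<eta>\<^sup>2 = 4 * (\<sigma> + 1)\<^sup>2"
    using \<eta>(1) by (simp add: k_def)
  have "d < \<eta>\<^sup>2"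
  proof (rule ccontr)
    assume "\<not> d < \<eta>\<^sup>2"
    then have "k * \<eta>\<^sup>2 \<le> k * d"
      using \<open>k > 0\<close> by (intro mult_left_mono) auto
    then have "k * \<eta>\<^sup>2 \<le> 2 * \<sigma>"
      using kd by simp
    moreover have "4 * (\<sigma> + 1)\<^sup>2 = 4 + 8 * \<sigma> + 4 * \<sigma>\<^sup>2"
      by (simp add: power2_eq_square algebra_simps)
    ultimately show False
      using k_eq \<open>\<sigma> \<ge> 0\<close> zero_le_power2[of \<sigma>] by linarith
  qed
  have "\<eta>\<^sup>2 \<le> \<eta>"
    using \<eta>(1) \<eta>_le by (simp add: power2_eq_square mult_le_cancel_left1)
  with \<open>d < \<eta>\<^sup>2\<close> have "d < \<eta>"
    by simp
  have "0 \<le> k / 2 * d\<^sup>2"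
    using \<open>k > 0\<close> by simp
  then have "e\<^sup>2 \<le> 2 * (\<sigma> * d)"
    using main by linarith
  then have "k * e\<^sup>2 \<le> k * (2 * (\<sigma> * d))"
    using \<open>k > 0\<close> by (intro mult_left_mono) auto
  also have "\<dots> \<le> 2 * \<sigma> * (2 * \<sigma>)"
    using mult_left_mono[OF kd, of "2 * \<sigma>"] \<open>\<sigma> \<ge> 0\<close> by (simp add: ac_simps)
  also have "\<dots> < k * \<eta>\<^sup>2"
    unfolding k_eq using \<open>\<sigma> \<ge> 0\<close> by (simp add: power2_eq_square algebra_simps)
  finally have "e\<^sup>2 < \<eta>\<^sup>2"
    using \<open>k > 0\<close> by simp
  then have "e < \<eta>"
    by (rule power2_less_imp_less) (use \<eta>(1) in simp)
  have "norm (y - L u) \<le> norm (L v - y) + norm (L (v - u))"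
    using norm_triangle_ineq4[of "L (v - u)" "L v - y"] by (simp add: linear_diff[OF L] algebra_simps)
  also have "\<dots> \<le> d + B * e"
    using B(2)[of "v - u"] by (simp add: d_def e_def)
  also have "\<dots> < \<eta> + B * \<eta>"
    using \<open>d < \<eta>\<close> \<open>e < \<eta>\<close> B(1) by (intro add_strict_mono mult_strict_left_mono)
  finally have y_less: "norm (y - L u) < min \<epsilon> 1"
    using \<eta>(2) unfolding distrib_right by linarith
  define l where "l = k *\<^sub>R (L v - y)"
  show thesis
  proof
    show "0 < t" "t < \<epsilon>" by fact+
    show "norm (v - u) < \<epsilon>"
      using \<open>e < \<eta>\<close> \<eta>_le by (simp add: e_def)
    show "norm (y - L u) < \<epsilon>"
      using y_less by simp
    show "norm l \<le> 2 * \<sigma>"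
      using kd \<open>k > 0\<close> by (simp add: l_def d_def)
    \<comment> \<open>For fixed v, y is locally a nearest point to \<open>L v\<close> in the
      rescaled set; expanding the square gives a proximal inequality. The radius below keeps the
      competitor \<open>y + h\<close> in the unit ball around \<open>L u\<close>.\<close>
    show "l \<in> frechet_normal_cone (z + t *\<^sub>R y) S"
    proof (rule proximal_imp_frechet_normal[OF y(2)])
      show "0 < t * (1 - norm (y - L u))"
        using t(1) y_less by simp
      fix x assume x: "x \<in> S" "norm (x - (z + t *\<^sub>R y)) < t * (1 - norm (y - L u))"
      define h where "h = (x - (z + t *\<^sub>R y)) /\<^sub>R t"
      have x_eq: "x = z + t *\<^sub>R (y + h)"
        using t(1) by (simp add: h_def algebra_simps)
      have x_diff: "x - (z + t *\<^sub>R y) = t *\<^sub>R h"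
        by (simp add: x_eq scaleR_add_right)
      have "norm h < 1 - norm (y - L u)"
        using x(2) t(1) by (simp add: x_diff)
      then have "norm (y + h - L u) \<le> 1"
        using norm_triangle_ineq[of "y - L u" h] by (simp add: algebra_simps)
      then have "(v, y + h) \<in> D"
        using vy(1) x(1) by (simp add: D_def x_eq dist_norm norm_minus_commute[of "L u"])
      then have "\<phi> (v, y) \<le> \<phi> (v, y + h)"
        by (rule vy(2))
      then have "k / 2 * (norm (L v - y))\<^sup>2 \<le> k / 2 * (norm (L v - (y + h)))\<^sup>2"
        by (simp add: \<phi>_def)
      then have "(norm (L v - y))\<^sup>2 \<le> (norm (L v - y - h))\<^sup>2"
        using \<open>k > 0\<close> by (simp add: diff_diff_eq)
      then have "2 * ((L v - y) \<bullet> h) \<le> h \<bullet> h"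
        unfolding power2_norm_eq_inner by (simp add: inner_diff_left inner_diff_right inner_commute)
      then have "k * t * (2 * ((L v - y) \<bullet> h)) \<le> k * t * (h \<bullet> h)"
        using \<open>k > 0\<close> t(1) by (intro mult_left_mono) auto
      then show "l \<bullet> (x - (z + t *\<^sub>R y)) \<le> k / (2 * t) * (norm (x - (z + t *\<^sub>R y)))\<^sup>2"
        using t(1) unfolding x_diff l_def power2_norm_eq_inner by (simp add: algebra_simps)
    qed
    \<comment> \<open>For fixed y, v is an interior minimiser over the ball, so the derivative in v
      vanishes; this is the multiplier equation with residual \<open>v - u\<close>.\<close>
    define \<psi> where "\<psi> v = \<phi> (v, y)" for v
    have dL: "((\<lambda>v. L v - y) has_derivative L) (at v)"
      using has_derivative_diff[OF linear_imp_has_derivative[OF L] has_derivative_const] by simp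
    have du: "((\<lambda>v. v - u) has_derivative (\<lambda>h. h)) (at v)"
      using has_derivative_diff[OF has_derivative_ident has_derivative_const] by simp
    have "((\<lambda>v. c \<bullet> v + k / 2 * ((L v - y) \<bullet> (L v - y)) + (v - u) \<bullet> (v - u) / 2) has_derivative
        (\<lambda>h. c \<bullet> h + k / 2 * ((L v - y) \<bullet> L h + L h \<bullet> (L v - y)) +
          ((v - u) \<bullet> h + h \<bullet> (v - u)) / 2)) (at v)"
      by (intro has_derivative_add has_derivative_mult_right has_derivative_inner[OF dL dL]
          has_derivative_inner_right[OF has_derivative_ident] has_derivative_inner[OF du du]
          bounded_linear.has_derivative[OF bounded_linear_divide])
    then have deriv: "(\<psi> has_derivative (\<lambda>h. c \<bullet> h + l \<bullet> L h + (v - u) \<bullet> h)) (at v)"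
      unfolding \<psi>_def[abs_def] \<phi>_def case_prod_conv power2_norm_eq_inner
      by (rule has_derivative_eq_rhs) (simp add: fun_eq_iff l_def inner_commute)
    have "(\<lambda>h. c \<bullet> h + l \<bullet> L h + (v - u) \<bullet> h) = (\<lambda>h. 0)"
    proof (rule differential_zero_maxmin[OF _ open_ball deriv])
      show "v \<in> ball u 1"
        using \<open>e < \<eta>\<close> \<eta>_le by (simp add: e_def dist_norm norm_minus_commute)
      show "(\<forall>x\<in>ball u 1. \<psi> x \<le> \<psi> v) \<or> (\<forall>x\<in>ball u 1. \<psi> v \<le> \<psi> x)"
        using vy by (auto simp: \<psi>_def D_def)
    qed
    then have "c \<bullet> h + l \<bullet> L h + (v - u) \<bullet> h = 0" for h
      by meson
    moreover have "adjoint L l \<bullet> h = l \<bullet> L h" for h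
      by (metis adjoint_works[OF L] inner_commute)
    ultimately have "(c + adjoint L l + (v - u)) \<bullet> h = 0" for h
      by (simp only: inner_add_left)
    then show "c + adjoint L l + (v - u) = 0"
      by (metis inner_eq_zero_iff)
  qed
qed

lemma LIMSEQ_norm_less_inverse:
  assumes "\<And>n. norm (f n) < inverse (real (Suc n))"
  shows "f \<longlonglongrightarrow> 0"
  by (rule Lim_null_comparison[OF always_eventually LIMSEQ_inverse_real_of_nat])
    (use assms in \<open>simp add: less_imp_le del: of_nat_Suc\<close>)

text \<open>Approximate multipliers for \<epsilon> = 1/(n+1) share the bound 2\<sigma>, so a
  subsequence converges while the residual \<open>v n - u\<close> vanishes.\<close>

lemma directional_multiplier_exists:
  fixes L :: "'a::euclidean_space \<Rightarrow> 'b::euclidean_space"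
  assumes "closed S" and "conic_near z S" and L: "linear L" and "exact_penalty c L z S"
    and u: "L u \<in> contingent_cone z S" "c \<bullet> u \<le> 0"
  obtains l where "l \<in> dir_normal_cone z S (L u)" and "c + adjoint L l = 0"
proof -
  obtain \<sigma> \<delta> where \<sigma>: "\<sigma> \<ge> 0" "\<delta> > 0"
    "\<And>v w. z + w \<in> S \<Longrightarrow> norm w < \<delta> \<Longrightarrow> - \<sigma> * norm (L v - w) \<le> c \<bullet> v"
    using assms(4) unfolding exact_penalty_def by blast
  obtain \<tau> where \<tau>: "\<tau> > 0" "\<And>s. 0 < s \<Longrightarrow> s < \<tau> \<Longrightarrow> z + s *\<^sub>R L u \<in> S"
    using contingent_cone_feasible_direction[OF assms(2,1) u(1)] by blast
  have "\<forall>n. \<exists>t v y l. 0 < t \<and> t < inverse (real (Suc n)) \<and> norm (v - u) < inverse (real (Suc n)) \<and>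
      norm (y - L u) < inverse (real (Suc n)) \<and> norm l \<le> 2 * \<sigma> \<and>
      l \<in> frechet_normal_cone (z + t *\<^sub>R y) S \<and> c + adjoint L l + (v - u) = 0"
  proof
    fix n
    show "\<exists>t v y l. 0 < t \<and> t < inverse (real (Suc n)) \<and> norm (v - u) < inverse (real (Suc n)) \<and>
      norm (y - L u) < inverse (real (Suc n)) \<and> norm l \<le> 2 * \<sigma> \<and>
      l \<in> frechet_normal_cone (z + t *\<^sub>R y) S \<and> c + adjoint L l + (v - u) = 0"
    proof -
      have pos: "0 < inverse (real (Suc n))"
        by simp
      obtain t v y l where "0 < t" "t < inverse (real (Suc n))"
        "norm (v - u) < inverse (real (Suc n))" "norm (y - L u) < inverse (real (Suc n))"
        "norm l \<le> 2 * \<sigma>" "l \<in> frechet_normal_cone (z + t *\<^sub>R y) S"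
        "c + adjoint L l + (v - u) = 0"
        by (rule approximate_multiplier[OF assms(1) L u(2) \<sigma> \<tau> pos])
      then show ?thesis
        by (intro exI conjI)
    qed
  qed
  then obtain t v y l where seq: "\<And>n. 0 < t n" "\<And>n. t n < inverse (real (Suc n))"
    "\<And>n. norm (v n - u) < inverse (real (Suc n))" "\<And>n. norm (y n - L u) < inverse (real (Suc n))"
    "\<And>n. norm (l n) \<le> 2 * \<sigma>" "\<And>n. l n \<in> frechet_normal_cone (z + t n *\<^sub>R y n) S"
    "\<And>n. c + adjoint L (l n) + (v n - u) = 0"
    by metis
  have t: "t \<longlonglongrightarrow> 0"
    using seq(1,2) by (intro LIMSEQ_norm_less_inverse) (simp add: abs_of_pos del: of_nat_Suc)
  have v: "v \<longlonglongrightarrow> u"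
    by (rule LIM_zero_cancel, rule LIMSEQ_norm_less_inverse, rule seq(3))
  have y: "y \<longlonglongrightarrow> L u"
    by (rule LIM_zero_cancel, rule LIMSEQ_norm_less_inverse, rule seq(4))
  have "\<forall>n. l n \<in> cball 0 (2 * \<sigma>)"
    using seq(5) by simp
  then obtain l0 r where r: "strict_mono (r :: nat \<Rightarrow> nat)" "(l \<circ> r) \<longlonglongrightarrow> l0"
    using compact_cball[of 0 "2 * \<sigma>", unfolded compact_def] by blast
  show thesis
  proof
    show "l0 \<in> dir_normal_cone z S (L u)"
      unfolding dir_normal_cone_def
      using seq(1,6) r LIMSEQ_subseq_LIMSEQ[OF t r(1)] LIMSEQ_subseq_LIMSEQ[OF y r(1)]
      by (intro CollectI exI[of _ "t \<circ> r"] exI[of _ "y \<circ> r"] exI[of _ "l \<circ> r"]) (auto simp: o_def)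
    have "(\<lambda>n. adjoint L ((l \<circ> r) n)) \<longlonglongrightarrow> adjoint L l0"
      using r(2) by (rule bounded_linear.tendsto[OF linear_conv_bounded_linear[THEN iffD1,
            OF adjoint_linear[OF L]]])
    then have "(\<lambda>n. c + adjoint L ((l \<circ> r) n) + ((v \<circ> r) n - u)) \<longlonglongrightarrow> c + adjoint L l0 + (u - u)"
      by (intro tendsto_intros LIMSEQ_subseq_LIMSEQ[OF v r(1)])
    then have "(\<lambda>n. 0) \<longlonglongrightarrow> c + adjoint L l0"
      by (simp add: seq(7))
    then show "c + adjoint L l0 = 0"
      by (simp add: LIMSEQ_const_iff)
  qed
qed

section \<open>The equivalence\<close>

text \<open>GGCQ equates only the polars of the two cones, which suffices because both sides say
  that \<open>- grad f x\<close> lies in a polar.\<close>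

lemma B_stationary_iff:
  assumes "x \<in> feasible_set F \<Omega>" and "GGCQ F \<Omega> x"
  shows "B_stationary f F \<Omega> x \<longleftrightarrow> (\<forall>u\<in>lin_cone F \<Omega> x. 0 \<le> grad f x \<bullet> u)"
proof -
  have "conic (lin_cone F \<Omega> x)"
    unfolding conic_def lin_cone_def
    by (auto simp: matrix_vector_mult_scaleR intro: conicD[OF conic_contingent_cone])
  moreover have "0 \<in> lin_cone F \<Omega> x"
    using assms(1) by (simp add: lin_cone_def feasible_set_def contingent_coneI)
  ultimately have "{\<xi>. \<forall>w\<in>contingent_cone x (feasible_set F \<Omega>). \<xi> \<bullet> w \<le> 0} =
      {\<xi>. \<forall>u\<in>lin_cone F \<Omega> x. \<xi> \<bullet> u \<le> 0}"
    using assms unfolding GGCQ_def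
    by (simp add: frechet_normal_cone_eq_polar[OF assms(1)] frechet_normal_cone_conic)
  then have "- grad f x \<in> {\<xi>. \<forall>w\<in>contingent_cone x (feasible_set F \<Omega>). \<xi> \<bullet> w \<le> 0} \<longleftrightarrow>
      - grad f x \<in> {\<xi>. \<forall>u\<in>lin_cone F \<Omega> x. \<xi> \<bullet> u \<le> 0}"
    by simp
  then show ?thesis
    by (simp add: B_stationary_def)
qed

theorem theorem3p9:
  fixes f :: "real^'n \<Rightarrow> real"
    and F :: "real^'n \<Rightarrow> real^'m"
    and P :: "nat \<Rightarrow> (real^'m) set" and p :: nat
    and \<Omega> :: "(real^'m) set"
    and xbar :: "real^'n"
    and U :: "nat \<Rightarrow> real^'n" and N :: nat
  assumes "cont_diff f" and "cont_diff F"
    and "\<And>i. i \<in> {1..p} \<Longrightarrow> polyhedron (P i)"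
    and "\<Omega> = (\<Union>i\<in>{1..p}. P i)"
    and "xbar \<in> feasible_set F \<Omega>"
    and "GGCQ F \<Omega> xbar"
    and "U ` {1..N} \<subseteq> lin_cone F \<Omega> xbar"
    and "convex hull (lin_cone F \<Omega> xbar) =
           {(\<Sum>i=1..N. \<alpha> i *\<^sub>R U i) | \<alpha> :: nat \<Rightarrow> real. \<forall>i\<in>{1..N}. \<alpha> i \<ge> 0}"
  shows "(B_stationary f F \<Omega> xbar
            \<longleftrightarrow> (\<forall>u \<in> lin_cone F \<Omega> xbar. grad f xbar \<bullet> u \<ge> 0)) \<and>
         ((\<forall>u \<in> lin_cone F \<Omega> xbar. grad f xbar \<bullet> u \<ge> 0)
            \<longleftrightarrow> extended_M_stationary f F \<Omega> xbar) \<and>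
         (extended_M_stationary f F \<Omega> xbar
            \<longleftrightarrow> (\<forall>u \<in> U ` {1..N} \<inter> critical_cone f F \<Omega> xbar.
                   multiplier_set f F \<Omega> xbar u \<noteq> {}))"
    (is "_ \<and> (?b \<longleftrightarrow> ?c) \<and> (_ \<longleftrightarrow> ?d)")
proof -
  define A where "A = jacobian F (at xbar)"
  define c where "c = grad f xbar"
  have polyhedra: "finite (P ` {1..p})" "\<And>S. S \<in> P ` {1..p} \<Longrightarrow> polyhedron S"
    using assms(3) by auto
  have near: "conic_near (F xbar) \<Omega>"
    unfolding assms(4) using polyhedra by (rule conic_near_Union_polyhedron)
  have "closed \<Omega>"
    unfolding assms(4) using assms(3) by (intro closed_UN) (auto intro: polyhedron_imp_closed)
  have adj: "adjoint ((*v) A) l = transpose A *v l" for l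
    by (simp add: adjoint_matrix)
  have "?c" if b: ?b
  proof -
    have "exact_penalty c ((*v) A) (F xbar) \<Omega>"
      unfolding assms(4) using polyhedra matrix_vector_mul_linear
    proof (rule exact_penalty_Union_polyhedron)
      fix v assume "A *v v \<in> contingent_cone (F xbar) (\<Union>(P ` {1..p}))"
      then show "0 \<le> c \<bullet> v"
        using b by (simp add: lin_cone_def assms(4) A_def c_def)
    qed
    then have "multiplier_set f F \<Omega> xbar u \<noteq> {}" if "u \<in> critical_cone f F \<Omega> xbar" for u
      using that directional_multiplier_exists[OF \<open>closed \<Omega>\<close> near matrix_vector_mul_linear, of c A u]
      unfolding critical_cone_def lin_cone_def multiplier_set_def adj A_def[symmetric] c_def[symmetric]
      by blast
    then show ?c
      by (simp add: extended_M_stationary_def)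
  qed
  moreover have "?d" if ?c
    using that by (simp add: extended_M_stationary_def)
  moreover have "?b" if d: ?d
  proof
    fix u assume u: "u \<in> lin_cone F \<Omega> xbar"
    have nonneg: "0 \<le> c \<bullet> U i" if i: "i \<in> {1..N}" for i
    \<comment> \<open>A generator with nonpositive product is critical, so (d) supplies l with
      \<open>c \<bullet> U i = - l \<bullet> (A *v U i)\<close>, which is nonnegative.\<close>
    proof (cases "c \<bullet> U i \<le> 0")
      case True
      then have "U i \<in> U ` {1..N} \<inter> critical_cone f F \<Omega> xbar"
        using i assms(7) by (auto simp: critical_cone_def c_def)
      then have "multiplier_set f F \<Omega> xbar (U i) \<noteq> {}"
        using d by blast
      then obtain l where l: "l \<in> dir_normal_cone (F xbar) \<Omega> (A *v U i)" "c + transpose A *v l = 0"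
        by (auto simp: multiplier_set_def A_def c_def)
      have "l \<bullet> (A *v U i) \<le> 0"
        using near l(1) by (rule dir_normal_cone_inner_nonpos)
      moreover have "(c + transpose A *v l) \<bullet> U i = 0"
        using l(2) by simp
      moreover have "(transpose A *v l) \<bullet> U i = l \<bullet> (A *v U i)"
        by (simp add: dot_lmul_matrix)
      ultimately show ?thesis
        by (simp add: inner_add_left)
    qed simp
    \<comment> \<open>u lies in the convex hull of the linearized cone, hence is a nonnegative
      combination of the generators.\<close>
    obtain \<alpha> where \<alpha>: "u = (\<Sum>i=1..N. \<alpha> i *\<^sub>R U i)" "\<forall>i\<in>{1..N}. 0 \<le> \<alpha> i"
      using hull_inc[OF u, of convex] unfolding assms(8) by blast
    have "c \<bullet> u = (\<Sum>i=1..N. \<alpha> i * (c \<bullet> U i))"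
      by (simp add: \<alpha>(1) inner_sum_right)
    also have "\<dots> \<ge> 0"
      using \<alpha>(2) nonneg by (intro sum_nonneg) auto
    finally show "0 \<le> grad f xbar \<bullet> u"
      by (simp add: c_def)
  qed
  moreover have "B_stationary f F \<Omega> xbar \<longleftrightarrow> ?b"
    using assms(5,6) by (rule B_stationary_iff)
  ultimately show ?thesis
    by blast
qed

end
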